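(* Suppose QM, CMR and the REACP hold (in the precise sense given in the context) and that the correlation $\langle a^{\bullet\circ}, b^{\circ\bullet}\rangle$, viewed as the function $F_4:\mathcal{Q}_+\to\mathbb{R}$ of $\boldsymbol{\theta}=(\theta_{ab},\theta_{a'b},\theta_{ab'})$, is twice differentiable at $\boldsymbol\theta=\mathbf{0}$ as a function restricted to $\mathcal{Q}_+$. Then it would follow that $3=1$ (i.e. these hypotheses are contradictory).
   Context: **Angles.** Angles lie in $\mathbf{T}=[-\pi,\pi]/(-\pi\sim\pi)$. For angles $\theta_c,\theta_d$ put $\theta_{cd}=\theta_c-\theta_d$. A quadruplet $\overline\theta=(\theta_a,\theta_{a'},\theta_b,\theta_{b'})\in\mathbf{T}^4$ consists of physical (actually used) angles $\theta_a$ (Alice), $\theta_b$ (Bob) and alternative angles $\theta_{a'}$ (Alice), $\theta_{b'}$ (Bob). Alice and Bob measure the normalized spin projections of the respective members of a sequence of spin-$\frac12$ pairs in the singlet state; corresponding measurements are space-like separated. **CMR (classical microscopic realism).** All observables that could be measured have well-defined values: for each realization (choice of physical angles) there are functions $(\alpha,\beta)\mapsto (A(\alpha,\beta),B(\alpha,\beta))$ with values in pairs of sequences indexed by $i\ge 1$ with entries in $\{-1,1\}$, where $A(\alpha,\beta)$ (resp. $B(\alpha,\beta)$) is the sequence Alice (resp. Bob) would obtain if Alice used the angle $\alpha$ and Bob the angle $\beta$. These functions may differ from one realization to another. For a quadruplet $\overline\theta$, in the realization with physical angles $\theta_a,\theta_b$, set $a^{\circ\circ}=A(\theta_a,\theta_b)$,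 $b^{\circ\circ}=B(\theta_a,\theta_b)$; $a^{\bullet\circ}=A(\theta_{a'},\theta_b)$, $b^{\bullet\circ}=B(\theta_{a'},\theta_b)$; $a^{\circ\bullet}=A(\theta_a,\theta_{b'})$, $b^{\circ\bullet}=B(\theta_a,\theta_{b'})$; $a^{\bullet\bullet}=A(\theta_{a'},\theta_{b'})$, $b^{\bullet\bullet}=B(\theta_{a'},\theta_{b'})$. **Correlations.** $\langle u,v\rangle=\lim_{n\to\infty}\frac1n\sum_{i=1}^n u_iv_i$; the limits defining the correlations $\langle a^{s_1t_1},b^{s_2t_2}\rangle$ used are assumed to exist. **QM.** Jointly measured or jointly measurable pairs obey the twisted Malus law: $\langle a^{\circ\circ},b^{\circ\circ}\rangle=-\cos\theta_{ab}$, $\langle a^{\circ\bullet},b^{\circ\bullet}\rangle=-\cos\theta_{ab'}$, $\langle a^{\bullet\circ},b^{\bullet\circ}\rangle=-\cos\theta_{a'b}$, $\langle a^{\bullet\bullet},b^{\bullet\bullet}\rangle=-\cos\theta_{a'b'}$. **REACP (restricted effect-after-cause principle).** For any Lorentz observer, the registered value of an observable for a physical choice of angle cannot change because of further choices that are made after registration. Concretely, each Lorentz observer $O$ has such functions $A^O,B^O$ ($A,B$ being those of some fixed observer). If for $O$ Bob's measurements precede Alice's corresponding ones, then $B^O(\alpha,\theta_b)$, with $\theta_b$ the physical angle, does not depend on Alice's choice $\alpha$; if for $O$ Alice's measurements precede Bob's, then $A^O(\theta_a,\beta)$, with $\theta_a$ the physical angle, does not depend on Bob's choice $\beta$. By space-like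 separation observers of both kinds exist. Moreover $a^{\circ\circ},a^{\circ\bullet},b^{\circ\circ},b^{\bullet\circ}$ are required not to depend on the Lorentz observer (nothing is required of the other sequences). **The function $F_4$.** $\mathcal{Q}_+=\{(\theta_1,\theta_2,\theta_3)\in\mathbb{R}^3: 0\le\theta_i\le\pi,\ i=1,2,3\}$. The correlation $\langle a^{\bullet\circ},b^{\circ\bullet}\rangle$ is regarded as a function of the three differences $\theta_1=\theta_{ab}$, $\theta_2=\theta_{a'b}$, $\theta_3=\theta_{ab'}$ only, and $F_4:\mathcal{Q}_+\to\mathbb{R}$ is $F_4(\boldsymbol\theta)=\langle a^{\bullet\circ},b^{\circ\bullet}\rangle$. Derivatives at points of $\mathcal{Q}_+$ are relative to $\mathcal{Q}_+$. *)

theory Defs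
  imports "HOL-Analysis.Analysis"
begin

(* The circle T = [-pi,pi]/(-pi ~ pi), presented as R/(2 pi Z) so that differences of angles
   are again angles. *)

definition angle_rel :: "real \<Rightarrow> real \<Rightarrow> bool" where
  "angle_rel x y \<longleftrightarrow> (\<exists>k::int. x - y = 2 * pi * of_int k)"

lemma equivp_angle_rel: "equivp angle_rel"
proof (rule equivpI)
  show "reflp angle_rel"
    by (auto intro!: reflpI exI[of _ 0] simp: angle_rel_def)
  show "symp angle_rel"
  proof (rule sympI)
    fix x y assume "angle_rel x y"
    then obtain k :: int where "x - y = 2 * pi * of_int k"
      by (auto simp: angle_rel_def)
    then have "y - x = 2 * pi * of_int (- k)" by simp
    then show "angle_rel y x" unfolding angle_rel_def by blast
  qed
  show "transp angle_rel"
  proof (rule transpI)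
    fix x y z assume "angle_rel x y" "angle_rel y z"
    then obtain k l :: int where "x - y = 2 * pi * of_int k" "y - z = 2 * pi * of_int l"
      by (auto simp: angle_rel_def)
    then have "x - z = 2 * pi * of_int (k + l)" by (simp add: algebra_simps)
    then show "angle_rel x z" unfolding angle_rel_def by blast
  qed
qed

quotient_type angle = real / angle_rel
  by (rule equivp_angle_rel)

instantiation angle :: ab_group_add
begin

lift_definition zero_angle :: angle is "0 :: real" .

lift_definition plus_angle :: "angle \<Rightarrow> angle \<Rightarrow> angle" is "(+) :: real \<Rightarrow> real \<Rightarrow> real"
proof -
  fix x y u v :: real
  assume "angle_rel x y" "angle_rel u v"
  then obtain k l :: int where "x - y = 2 * pi * of_int k" "u - v = 2 * pi * of_int l"
    by (auto simp: angle_rel_def)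
  then have "(x + u) - (y + v) = 2 * pi * of_int (k + l)" by (simp add: algebra_simps)
  then show "angle_rel (x + u) (y + v)" unfolding angle_rel_def by blast
qed

lift_definition minus_angle :: "angle \<Rightarrow> angle \<Rightarrow> angle" is "(-) :: real \<Rightarrow> real \<Rightarrow> real"
proof -
  fix x y u v :: real
  assume "angle_rel x y" "angle_rel u v"
  then obtain k l :: int where "x - y = 2 * pi * of_int k" "u - v = 2 * pi * of_int l"
    by (auto simp: angle_rel_def)
  then have "(x - u) - (y - v) = 2 * pi * of_int (k - l)" by (simp add: algebra_simps)
  then show "angle_rel (x - u) (y - v)" unfolding angle_rel_def by blast
qed

lift_definition uminus_angle :: "angle \<Rightarrow> angle" is "uminus :: real \<Rightarrow> real"
proof -
  fix x y :: real
  assume "angle_rel x y"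
  then obtain k :: int where "x - y = 2 * pi * of_int k" by (auto simp: angle_rel_def)
  then have "(- x) - (- y) = 2 * pi * of_int (- k)" by (simp add: algebra_simps)
  then show "angle_rel (- x) (- y)" unfolding angle_rel_def by blast
qed

instance
  by standard (transfer; use equivp_reflp[OF equivp_angle_rel] in \<open>simp add: algebra_simps\<close>)+

end

lift_definition angle_of :: "real \<Rightarrow> angle" is "\<lambda>x. x" .

lift_definition angle_cos :: "angle \<Rightarrow> real" is cos
proof -
  fix x y :: real
  assume "angle_rel x y"
  then obtain k :: int where "x - y = 2 * pi * of_int k" by (auto simp: angle_rel_def)
  then have "x = y + 2 * pi * of_int k" by simp
  moreover have "sin (2 * pi * of_int k) = 0" "cos (2 * pi * of_int k) = 1"
    by (simp_all add: sin_int_2pin cos_int_2pin)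
  ultimately show "cos x = cos y" by (simp add: cos_add)
qed

datatype quadruplet =
  Quadruplet (th_a: angle) (th_a': angle) (th_b: angle) (th_b': angle)

(* Phys is the white circle (physical angle), Alt the black bullet (alternative angle). *)

datatype setting = Phys | Alt

fun alice_angle :: "quadruplet \<Rightarrow> setting \<Rightarrow> angle" where
  "alice_angle q Phys = th_a q"
| "alice_angle q Alt = th_a' q"

fun bob_angle :: "quadruplet \<Rightarrow> setting \<Rightarrow> angle" where
  "bob_angle q Phys = th_b q"
| "bob_angle q Alt = th_b' q"

(* Outcome sequences are indexed by i >= 1; the entry at 0 is never looked at. *)

type_synonym outcomes = "nat \<Rightarrow> real"

definition same_outcomes :: "outcomes \<Rightarrow> outcomes \<Rightarrow> bool" where
  "same_outcomes u v \<longleftrightarrow> (\<forall>i\<ge>1. u i = v i)"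

(* For A, B of this type, A p q x y and B p q x y are the sequences that Alice and Bob would
   obtain with the angles x (Alice) and y (Bob), according to the realization whose physical
   angles are p (Alice) and q (Bob). *)

type_synonym outcome_fun = "angle \<Rightarrow> angle \<Rightarrow> angle \<Rightarrow> angle \<Rightarrow> outcomes"

definition outcome_seq :: "outcome_fun \<Rightarrow> quadruplet \<Rightarrow> setting \<Rightarrow> setting \<Rightarrow> outcomes" where
  "outcome_seq X q s t = X (th_a q) (th_b q) (alice_angle q s) (bob_angle q t)"

(* The correlation of u and v exists and equals c. *)

definition has_correlation :: "outcomes \<Rightarrow> outcomes \<Rightarrow> real \<Rightarrow> bool" where
  "has_correlation u v c \<longleftrightarrow> (\<lambda>n. (1 / real n) * (\<Sum>i=1..n. u i * v i)) \<longlonglongrightarrow> c"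

(* One pair of functions for each Lorentz observer and each realization. *)

definition CMR :: "('obs \<Rightarrow> outcome_fun) \<Rightarrow> ('obs \<Rightarrow> outcome_fun) \<Rightarrow> bool" where
  "CMR A B \<longleftrightarrow>
     (\<forall>obs p q x y. \<forall>i\<ge>1. A obs p q x y i \<in> {-1, 1} \<and> B obs p q x y i \<in> {-1, 1})"

definition QM :: "outcome_fun \<Rightarrow> outcome_fun \<Rightarrow> bool" where
  "QM A B \<longleftrightarrow>
     (\<forall>q s t. has_correlation (outcome_seq A q s t) (outcome_seq B q s t)
                (- angle_cos (alice_angle q s - bob_angle q t)))"

(* tA obs i and tB obs i are the times at which, for obs, the i-th measurements of Alice and
   of Bob take place.  Space-like separation means that neither order is common to all
   observers; what is used of it is that observers of both kinds exist. *)

definition alice_first :: "('obs \<Rightarrow> nat \<Rightarrow> real) \<Rightarrow> ('obs \<Rightarrow> nat \<Rightarrow> real) \<Rightarrow> 'obs \<Rightarrow> bool" where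
  "alice_first tA tB obs \<longleftrightarrow> (\<forall>i\<ge>1. tA obs i < tB obs i)"

definition bob_first :: "('obs \<Rightarrow> nat \<Rightarrow> real) \<Rightarrow> ('obs \<Rightarrow> nat \<Rightarrow> real) \<Rightarrow> 'obs \<Rightarrow> bool" where
  "bob_first tA tB obs \<longleftrightarrow> (\<forall>i\<ge>1. tB obs i < tA obs i)"

definition observers_of_both_kinds ::
  "('obs \<Rightarrow> nat \<Rightarrow> real) \<Rightarrow> ('obs \<Rightarrow> nat \<Rightarrow> real) \<Rightarrow> bool" where
  "observers_of_both_kinds tA tB \<longleftrightarrow>
     (\<exists>obs. alice_first tA tB obs) \<and> (\<exists>obs. bob_first tA tB obs)"

definition effect_after_cause ::
  "('obs \<Rightarrow> nat \<Rightarrow> real) \<Rightarrow> ('obs \<Rightarrow> nat \<Rightarrow> real) \<Rightarrow>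
   ('obs \<Rightarrow> outcome_fun) \<Rightarrow> ('obs \<Rightarrow> outcome_fun) \<Rightarrow> bool" where
  "effect_after_cause tA tB A B \<longleftrightarrow>
     (\<forall>obs. bob_first tA tB obs \<longrightarrow>
        (\<forall>p q x x'. same_outcomes (B obs p q x q) (B obs p q x' q))) \<and>
     (\<forall>obs. alice_first tA tB obs \<longrightarrow>
        (\<forall>p q y y'. same_outcomes (A obs p q p y) (A obs p q p y')))"

definition observer_independent ::
  "('obs \<Rightarrow> outcome_fun) \<Rightarrow> ('obs \<Rightarrow> outcome_fun) \<Rightarrow> bool" where
  "observer_independent A B \<longleftrightarrow>
     (\<forall>obs obs' q.
        same_outcomes (outcome_seq (A obs) q Phys Phys) (outcome_seq (A obs') q Phys Phys) \<and>
        same_outcomes (outcome_seq (A obs) q Phys Alt) (outcome_seq (A obs') q Phys Alt) \<and>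
        same_outcomes (outcome_seq (B obs) q Phys Phys) (outcome_seq (B obs') q Phys Phys) \<and>
        same_outcomes (outcome_seq (B obs) q Alt Phys) (outcome_seq (B obs') q Alt Phys))"

definition REACP ::
  "('obs \<Rightarrow> nat \<Rightarrow> real) \<Rightarrow> ('obs \<Rightarrow> nat \<Rightarrow> real) \<Rightarrow>
   ('obs \<Rightarrow> outcome_fun) \<Rightarrow> ('obs \<Rightarrow> outcome_fun) \<Rightarrow> bool" where
  "REACP tA tB A B \<longleftrightarrow> effect_after_cause tA tB A B \<and> observer_independent A B"

definition Q_plus :: "(real ^ 3) set" where
  "Q_plus = {\<theta>. \<forall>i. 0 \<le> \<theta> $ i \<and> \<theta> $ i \<le> pi}"

(* Only the values of F on Q_plus are constrained; angle_of is injective on [0,pi], so theta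
   in Q_plus is determined by the three differences of angles. *)

definition is_F4 :: "outcome_fun \<Rightarrow> outcome_fun \<Rightarrow> (real ^ 3 \<Rightarrow> real) \<Rightarrow> bool" where
  "is_F4 A B F \<longleftrightarrow>
     (\<forall>q. \<forall>\<theta>\<in>Q_plus.
        th_a q - th_b q = angle_of (\<theta> $ 1) \<longrightarrow>
        th_a' q - th_b q = angle_of (\<theta> $ 2) \<longrightarrow>
        th_a q - th_b' q = angle_of (\<theta> $ 3) \<longrightarrow>
        has_correlation (outcome_seq A q Alt Phys) (outcome_seq B q Phys Alt) (F \<theta>))"

(* Derivatives are taken relative to S, also at the points near x. *)

definition twice_differentiable_at_within ::
  "('a::real_normed_vector \<Rightarrow> 'b::real_normed_vector) \<Rightarrow> 'a \<Rightarrow> 'a set \<Rightarrow> bool" where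
  "twice_differentiable_at_within f x S \<longleftrightarrow>
     (\<exists>U (f' :: 'a \<Rightarrow> ('a \<Rightarrow>\<^sub>L 'b)).
        open U \<and> x \<in> U \<and>
        (\<forall>y\<in>U \<inter> S. (f has_derivative blinfun_apply (f' y)) (at y within S)) \<and>
        f' differentiable (at x within S))"

end

theory Submission
  imports Defs "HOL-Real_Asymp.Real_Asymp"
begin

text \<open>
  Write \<open>a, b\<close> for the physical and \<open>a', b'\<close> for the alternative sequences that are left once the
  restricted effect-after-cause principle identifies \<open>a\<^sup>\<circ>\<^sup>\<bullet>\<close> with \<open>a\<^sup>\<circ>\<^sup>\<circ>\<close> and \<open>b\<^sup>\<bullet>\<^sup>\<circ>\<close> with \<open>b\<^sup>\<circ>\<^sup>\<circ>\<close>.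
  Bell's inequality gives \<open>F\<^sub>4 \<theta> \<le> 2 - cos \<theta>\<^sub>1 - cos \<theta>\<^sub>2 - cos \<theta>\<^sub>3\<close>, and trivially \<open>F\<^sub>4 \<ge> -1\<close>. If
  \<open>\<theta>\<^sub>1 = \<theta>\<^sub>2\<close>, then Alice's alternative angle is the physical one and \<open>F\<^sub>4 \<theta> = - cos \<theta>\<^sub>3\<close>; if
  \<open>\<theta>\<^sub>1 = \<theta>\<^sub>3\<close>, then \<open>F\<^sub>4 \<theta> = - cos \<theta>\<^sub>2\<close>. The alternating sum of \<open>F\<^sub>4\<close> over the vertices of the cube
  \<open>[0,t]\<^sup>3\<close> is \<open>o(t\<^sup>2)\<close> by Taylor's formula, because a polynomial of degree two has vanishing third
  mixed difference. On the other hand, the above makes it at least \<open>1 - cos t\<close>, which is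
  asymptotic to \<open>t\<^sup>2 / 2\<close>.
\<close>

section \<open>Taylor's formula of order two relative to a convex set\<close>

text \<open>Along the segment from \<open>x\<close> to \<open>x + v\<close> the remainder has
  derivative \<open>(f' (x + u v) - f' x - D (u v)) v\<close>, which is o(u) because
  \<open>f'\<close> is differentiable at \<open>x\<close>; the mean value inequality turns this into
  o(t^2). Convexity keeps the segment in \<open>S\<close>, so \<open>x\<close> may lie on the
  boundary.\<close>

lemma twice_differentiable_at_within_taylor:
  fixes f :: "'a::real_normed_vector \<Rightarrow> 'b::real_normed_vector"
  assumes "twice_differentiable_at_within f x S" "convex S" "x \<in> S"
  obtains L :: "'a \<Rightarrow>\<^sub>L 'b" and D :: "'a \<Rightarrow> 'a \<Rightarrow>\<^sub>L 'b" where "linear D"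
    "\<And>v. x + v \<in> S \<Longrightarrow>
       ((\<lambda>t. (1 / t\<^sup>2) *\<^sub>R (f (x + t *\<^sub>R v) - f x - t *\<^sub>R L v - (t\<^sup>2 / 2) *\<^sub>R D v v)) \<longlongrightarrow> 0)
         (at_right 0)"
proof -
  obtain U and f' :: "'a \<Rightarrow> 'a \<Rightarrow>\<^sub>L 'b" and D where U: "open U" "x \<in> U"
    and f': "\<And>y. y \<in> U \<inter> S \<Longrightarrow> (f has_derivative blinfun_apply (f' y)) (at y within S)"
    and D: "(f' has_derivative D) (at x within S)"
    using assms(1) unfolding twice_differentiable_at_within_def differentiable_def by blast
  from D have "linear D" by (rule has_derivative_linear)
  moreover have "((\<lambda>t. (1 / t\<^sup>2) *\<^sub>R (f (x + t *\<^sub>R v) - f x - t *\<^sub>R f' x v - (t\<^sup>2 / 2) *\<^sub>R D v v)) \<longlongrightarrow> 0)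
         (at_right 0)" if v: "x + v \<in> S" for v
  proof (rule tendstoI)
    fix e :: real assume "e > 0"
    define g where "g t = f (x + t *\<^sub>R v) - f x - t *\<^sub>R f' x v - (t\<^sup>2 / 2) *\<^sub>R D v v" for t :: real
    \<comment> \<open>The summand 1 keeps \<open>N\<close> positive when \<open>v = 0\<close>; the 2
      in \<open>\<epsilon>\<close> makes the final bound \<open>e / 2\<close>, strictly below
      \<open>e\<close>.\<close>
    define N where "N = 1 + (norm v)\<^sup>2"
    define \<epsilon> where "\<epsilon> = e / (2 * N)"
    have "N > 0" unfolding N_def by (simp add: add_pos_nonneg)
    with \<open>e > 0\<close> have "\<epsilon> > 0" by (simp add: \<epsilon>_def)
    have "\<exists>d>0. \<forall>y\<in>S. norm (y - x) < d \<longrightarrow> norm (f' y - f' x - D (y - x)) \<le> \<epsilon> * norm (y - x)"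
      using D \<open>\<epsilon> > 0\<close> unfolding has_derivative_within_alt by blast
    then obtain d where "d > 0"
      and d: "\<And>y. y \<in> S \<Longrightarrow> norm (y - x) < d \<Longrightarrow>
            norm (f' y - f' x - D (y - x)) \<le> \<epsilon> * norm (y - x)" by blast
    obtain r where "r > 0" and r: "ball x r \<subseteq> U"
      using U openE by blast
    \<comment> \<open>The bound 1 keeps \<open>x + t v\<close> on the segment to
      \<open>x + v\<close>; the other bound forces \<open>norm (t v) < min d r\<close>.\<close>
    define s where "s = min 1 (min d r / (1 + norm v))"
    have "1 + norm v > 0" by (simp add: add_pos_nonneg)
    then have "s > 0" using \<open>d > 0\<close> \<open>r > 0\<close> by (simp add: s_def)
    have near: "x + t *\<^sub>R v \<in> S" "norm (t *\<^sub>R v) < d" "x + t *\<^sub>R v \<in> U" if "0 \<le> t" "t < s" for t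
    proof -
      have "(1 - t) *\<^sub>R x + t *\<^sub>R (x + v) \<in> S"
        using that assms v by (intro convexD) (auto simp: s_def)
      then show "x + t *\<^sub>R v \<in> S" by (simp add: algebra_simps)
      have "t * (1 + norm v) < min d r"
        using that \<open>1 + norm v > 0\<close> by (simp add: s_def pos_less_divide_eq)
      then have "norm (t *\<^sub>R v) < min d r" using that by (simp add: algebra_simps)
      then show "norm (t *\<^sub>R v) < d" "x + t *\<^sub>R v \<in> U"
        using r by (auto simp: dist_norm)
    qed
    have bound: "norm (g t) \<le> \<epsilon> * N * t\<^sup>2" if t: "0 < t" "t < s" for t
    proof -
      have "norm (g t - g 0) \<le> (\<epsilon> * N * t) * norm (t - 0)"
      proof (rule differentiable_bound[where S = "{0..t}" and
            f' = "\<lambda>u h. h *\<^sub>R blinfun_apply (f' (x + u *\<^sub>R v) - f' x - D (u *\<^sub>R v)) v"])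
        fix u assume u: "u \<in> {0..t}"
        have us: "0 \<le> u" "u < s" using u t by auto
        have "((\<lambda>u. x + u *\<^sub>R v) has_derivative (\<lambda>h. h *\<^sub>R v)) (at u within {0..t})"
          by (auto intro!: derivative_eq_intros)
        moreover have "(f has_derivative f' (x + u *\<^sub>R v)) (at (x + u *\<^sub>R v) within (\<lambda>u. x + u *\<^sub>R v) ` {0..t})"
          using near t by (intro has_derivative_subset[OF f'[of "x + u *\<^sub>R v"]]) (auto simp: us)
        ultimately have "((\<lambda>u. f (x + u *\<^sub>R v)) has_derivative (\<lambda>h. f' (x + u *\<^sub>R v) (h *\<^sub>R v)))
            (at u within {0..t})"
          using has_derivative_in_compose by blast
        then show "(g has_derivative (\<lambda>h. h *\<^sub>R blinfun_apply (f' (x + u *\<^sub>R v) - f' x - D (u *\<^sub>R v)) v))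
            (at u within {0..t})"
          unfolding g_def
          by (auto intro!: derivative_eq_intros
              simp: blinfun.bilinear_simps linear_scale[OF \<open>linear D\<close>] scaleR_right_diff_distrib)
        have "norm (blinfun_apply (f' (x + u *\<^sub>R v) - f' x - D (u *\<^sub>R v)) v)
            \<le> norm (f' (x + u *\<^sub>R v) - f' x - D (u *\<^sub>R v)) * norm v"
          by (rule norm_blinfun)
        also have "\<dots> \<le> (\<epsilon> * norm (u *\<^sub>R v)) * norm v"
          using d[of "x + u *\<^sub>R v"] near us by (intro mult_right_mono) auto
        also have "\<dots> = \<epsilon> * (norm v)\<^sup>2 * u"
          using us by (simp add: power2_eq_square)
        also have "\<dots> \<le> \<epsilon> * N * t"
          using u \<open>\<epsilon> > 0\<close> by (intro mult_mono) (auto simp: N_def)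
        finally have *: "norm (blinfun_apply (f' (x + u *\<^sub>R v) - f' x - D (u *\<^sub>R v)) v) \<le> \<epsilon> * N * t" .
        then show "onorm (\<lambda>h. h *\<^sub>R blinfun_apply (f' (x + u *\<^sub>R v) - f' x - D (u *\<^sub>R v)) v) \<le> \<epsilon> * N * t"
          by (intro onorm_le) (simp add: mult_left_mono mult.commute[of _ "\<bar>_\<bar>"])
      qed (use t in auto)
      then show ?thesis using t by (simp add: g_def power2_eq_square linear_0[OF \<open>linear D\<close>])
    qed
    have "\<epsilon> * N < e" using \<open>e > 0\<close> \<open>N > 0\<close> by (simp add: \<epsilon>_def)
    have "dist ((1 / t\<^sup>2) *\<^sub>R g t) 0 < e" if t: "0 < t" "t < s" for t
    proof -
      have "norm ((1 / t\<^sup>2) *\<^sub>R g t) \<le> \<epsilon> * N"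
        using bound[OF t] t by (simp add: divide_le_eq)
      with \<open>\<epsilon> * N < e\<close> show ?thesis by simp
    qed
    then show "\<forall>\<^sub>F t in at_right 0.
        dist ((1 / t\<^sup>2) *\<^sub>R (f (x + t *\<^sub>R v) - f x - t *\<^sub>R f' x v - (t\<^sup>2 / 2) *\<^sub>R D v v)) 0 < e"
      unfolding eventually_at_right_field g_def using \<open>s > 0\<close> by blast
  qed
  ultimately show thesis by (rule that)
qed

text \<open>Constant, linear and quadratic Taylor terms all cancel in the alternating sum over the
  vertices, leaving only remainders. The map \<open>v \<mapsto> D v v\<close> is quadratic whether
  or not \<open>D\<close> is symmetric.\<close>

lemma third_mixed_difference_tendsto_0:
  fixes f :: "'a::real_normed_vector \<Rightarrow> real"
  assumes "twice_differentiable_at_within f 0 S" "convex S"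
    and "0 \<in> S" "x \<in> S" "y \<in> S" "z \<in> S" "x + y \<in> S" "x + z \<in> S" "y + z \<in> S" "x + y + z \<in> S"
  shows "((\<lambda>t. (f (t *\<^sub>R (x + y + z)) - f (t *\<^sub>R (x + y)) - f (t *\<^sub>R (x + z)) - f (t *\<^sub>R (y + z))
            + f (t *\<^sub>R x) + f (t *\<^sub>R y) + f (t *\<^sub>R z) - f 0) / t\<^sup>2) \<longlongrightarrow> 0) (at_right 0)"
proof -
  obtain L :: "'a \<Rightarrow>\<^sub>L real" and D :: "'a \<Rightarrow> 'a \<Rightarrow>\<^sub>L real" where D: "linear D"
    and taylor: "\<And>v. 0 + v \<in> S \<Longrightarrow>
       ((\<lambda>t. (1 / t\<^sup>2) *\<^sub>R (f (0 + t *\<^sub>R v) - f 0 - t *\<^sub>R L v - (t\<^sup>2 / 2) *\<^sub>R D v v)) \<longlongrightarrow> 0)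
         (at_right 0)"
    using twice_differentiable_at_within_taylor[OF assms(1-3)] by blast
  define r where "r v t = (1 / t\<^sup>2) *\<^sub>R (f (0 + t *\<^sub>R v) - f 0 - t *\<^sub>R L v - (t\<^sup>2 / 2) *\<^sub>R D v v)" for v t
  have r: "(r v \<longlongrightarrow> 0) (at_right 0)" if "v \<in> S" for v
    using taylor[of v] that by (simp add: r_def[abs_def])
  have "((\<lambda>t. r (x + y + z) t - r (x + y) t - r (x + z) t - r (y + z) t + r x t + r y t + r z t)
      \<longlongrightarrow> 0 - 0 - 0 - 0 + 0 + 0 + 0) (at_right 0)"
    by (intro tendsto_intros r assms)
  \<comment> \<open>The seven signs add up to 1, so the constants leave exactly one
    \<open>- f 0\<close>, the value at the eighth vertex.\<close>
  moreover have "r (x + y + z) t - r (x + y) t - r (x + z) t - r (y + z) t + r x t + r y t + r z t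
      = (f (t *\<^sub>R (x + y + z)) - f (t *\<^sub>R (x + y)) - f (t *\<^sub>R (x + z)) - f (t *\<^sub>R (y + z))
            + f (t *\<^sub>R x) + f (t *\<^sub>R y) + f (t *\<^sub>R z) - f 0) / t\<^sup>2" for t
    unfolding r_def by (simp add: linear_add[OF D] blinfun.bilinear_simps add_divide_distrib
        diff_divide_distrib algebra_simps)
  ultimately show ?thesis by simp
qed

section \<open>Correlations\<close>

lemma has_correlation_cong:
  assumes "same_outcomes u u'" "same_outcomes v v'"
  shows "has_correlation u v c \<longleftrightarrow> has_correlation u' v' c"
proof -
  have "(\<Sum>i=1..n. u i * v i) = (\<Sum>i=1..n. u' i * v' i)" for n
    using assms by (intro sum.cong) (auto simp: same_outcomes_def)
  then show ?thesis by (simp add: has_correlation_def)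
qed

lemma has_correlation_unique:
  "has_correlation u v c \<Longrightarrow> has_correlation u v c' \<Longrightarrow> c = c'"
  unfolding has_correlation_def using LIMSEQ_unique by blast

lemma has_correlation_ge:
  assumes "\<And>i. i \<ge> 1 \<Longrightarrow> u i \<in> {-1, 1}" "\<And>i. i \<ge> 1 \<Longrightarrow> v i \<in> {-1, 1}" "has_correlation u v c"
  shows "c \<ge> -1"
proof (rule LIMSEQ_le_const[OF assms(3)[unfolded has_correlation_def]], intro exI allI impI)
  fix n :: nat assume "1 \<le> n"
  have "(\<Sum>i=1..n. u i * v i) \<ge> (\<Sum>i=1..n. -1)"
    by (rule sum_mono) (use assms(1,2) in fastforce)
  then show "-1 \<le> (1 / real n) * (\<Sum>i=1..n. u i * v i)"
    using \<open>1 \<le> n\<close> by (simp add: field_simps)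
qed

text \<open>Termwise, \<open>a' (b' - b) - a (b + b') \<le> 2\<close>, since one of
  \<open>b' - b\<close> and \<open>b + b'\<close> vanishes and the other is 2 or -2; averaging and
  passing to the limit preserves this.\<close>

lemma bell_inequality:
  assumes "\<And>i. i \<ge> 1 \<Longrightarrow> a i \<in> {-1, 1}" "\<And>i. i \<ge> 1 \<Longrightarrow> a' i \<in> {-1, 1}"
    and "\<And>i. i \<ge> 1 \<Longrightarrow> b i \<in> {-1, 1}" "\<And>i. i \<ge> 1 \<Longrightarrow> b' i \<in> {-1, 1}"
    and "has_correlation a b c1" "has_correlation a' b c2" "has_correlation a b' c3"
    and "has_correlation a' b' c4"
  shows "c4 \<le> 2 + c1 + c2 + c3"
proof -
  let ?m = "\<lambda>u v n. (1 / real n) * (\<Sum>i=1..n. u i * v i)"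
  have "(\<lambda>n. 2 + ?m a b n + ?m a' b n + ?m a b' n) \<longlonglongrightarrow> 2 + c1 + c2 + c3"
    using assms(5-7) unfolding has_correlation_def by (intro tendsto_intros)
  moreover have "?m a' b' \<longlonglongrightarrow> c4"
    using assms(8) unfolding has_correlation_def .
  moreover have "?m a' b' n \<le> 2 + ?m a b n + ?m a' b n + ?m a b' n" if "1 \<le> n" for n
  proof -
    have "(\<Sum>i=1..n. a' i * b' i) \<le> (\<Sum>i=1..n. 2 + a i * b i + a' i * b i + a i * b' i)"
    proof (rule sum_mono)
      fix i assume "i \<in> {1..n}"
      then have "a i \<in> {-1, 1}" "a' i \<in> {-1, 1}" "b i \<in> {-1, 1}" "b' i \<in> {-1, 1}"
        using assms(1-4) by auto
      then show "a' i * b' i \<le> 2 + a i * b i + a' i * b i + a i * b' i" by auto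
    qed
    then show ?thesis using that by (simp add: sum.distrib field_simps)
  qed
  ultimately show ?thesis by (intro LIMSEQ_le) auto
qed

section \<open>Consequences of the principle\<close>

lemma angle_cos_angle_of [simp]: "angle_cos (angle_of x) = cos x"
  by transfer simp

lemma angle_of_diff: "angle_of (x - y) = angle_of x - angle_of y"
  by transfer (simp add: equivp_reflp[OF equivp_angle_rel])

text \<open>The two equalities come from different observers, one for whom Alice is first and one
  for whom Bob is; observer independence of the four sequences carries both over to
  \<open>obs0\<close>.\<close>

lemma REACP_same_outcomes:
  assumes "observers_of_both_kinds tA tB" "REACP tA tB A B"
  shows "same_outcomes (outcome_seq (A obs0) q Phys Alt) (outcome_seq (A obs0) q Phys Phys)"
    and "same_outcomes (outcome_seq (B obs0) q Alt Phys) (outcome_seq (B obs0) q Phys Phys)"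
proof -
  obtain oa ob where "alice_first tA tB oa" "bob_first tA tB ob"
    using assms(1) unfolding observers_of_both_kinds_def by blast
  then have "same_outcomes (outcome_seq (A oa) q Phys Alt) (outcome_seq (A oa) q Phys Phys)"
    "same_outcomes (outcome_seq (B ob) q Alt Phys) (outcome_seq (B ob) q Phys Phys)"
    using assms(2) by (auto simp: REACP_def effect_after_cause_def outcome_seq_def)
  moreover have "observer_independent A B"
    using assms(2) by (simp add: REACP_def)
  ultimately show
    "same_outcomes (outcome_seq (A obs0) q Phys Alt) (outcome_seq (A obs0) q Phys Phys)"
    "same_outcomes (outcome_seq (B obs0) q Alt Phys) (outcome_seq (B obs0) q Phys Phys)"
    unfolding observer_independent_def same_outcomes_def by metis+
qed

lemma F4_properties:
  assumes cmr: "CMR A B" and qm: "QM (A obs0) (B obs0)"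
    and reacp: "observers_of_both_kinds tA tB" "REACP tA tB A B"
    and F4: "is_F4 (A obs0) (B obs0) F" and \<theta>: "\<theta> \<in> Q_plus"
  shows F4_ge: "F \<theta> \<ge> -1"
    and F4_le: "F \<theta> \<le> 2 - cos (\<theta> $ 1) - cos (\<theta> $ 2) - cos (\<theta> $ 3)"
    and F4_eq_12: "\<theta> $ 1 = \<theta> $ 2 \<Longrightarrow> F \<theta> = - cos (\<theta> $ 3)"
    and F4_eq_13: "\<theta> $ 1 = \<theta> $ 3 \<Longrightarrow> F \<theta> = - cos (\<theta> $ 2)"
proof -
  \<comment> \<open>Bob's physical angle is normalized to 0; the three differences then fix the
    other angles.\<close>
  define q where "q = Quadruplet (angle_of (\<theta> $ 1)) (angle_of (\<theta> $ 2)) (angle_of 0)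
      (angle_of (\<theta> $ 1 - \<theta> $ 3))"
  have "has_correlation (outcome_seq (A obs0) q s t) (outcome_seq (B obs0) q s t)
      (- angle_cos (alice_angle q s - bob_angle q t))" for s t
    using qm unfolding QM_def by blast
  note corr = this[of Phys Phys] this[of Alt Phys] this[of Phys Alt]
  let ?a = "outcome_seq (A obs0) q Phys Phys" and ?a' = "outcome_seq (A obs0) q Alt Phys"
  let ?b = "outcome_seq (B obs0) q Phys Phys" and ?b' = "outcome_seq (B obs0) q Phys Alt"
  have refl: "same_outcomes u u" for u by (simp add: same_outcomes_def)
  note same = REACP_same_outcomes[OF reacp, of obs0 q]
  have ab: "has_correlation ?a ?b (- cos (\<theta> $ 1))"
    using corr(1) by (simp add: q_def flip: angle_of_diff)
  \<comment> \<open>Here the cosine law concerns Bob's sequence for settings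
    \<open>Alt Phys\<close>, which the principle lets \<open>?b\<close> replace; for
    \<open>ab'\<close> it is Alice's sequence that is replaced.\<close>
  have a'b: "has_correlation ?a' ?b (- cos (\<theta> $ 2))"
    using corr(2) has_correlation_cong[OF refl same(2)]
    by (simp add: q_def flip: angle_of_diff)
  have ab': "has_correlation ?a ?b' (- cos (\<theta> $ 3))"
    using corr(3) has_correlation_cong[OF same(1) refl]
    by (simp add: q_def flip: angle_of_diff)
  have a'b': "has_correlation ?a' ?b' (F \<theta>)"
    using F4 \<theta> unfolding is_F4_def by (simp add: q_def flip: angle_of_diff)
  have pm: "\<And>i. i \<ge> 1 \<Longrightarrow> outcome_seq (A obs0) q s t i \<in> {-1, 1}"
    "\<And>i. i \<ge> 1 \<Longrightarrow> outcome_seq (B obs0) q s t i \<in> {-1, 1}" for s t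
    using cmr unfolding CMR_def outcome_seq_def by blast+
  show "F \<theta> \<ge> -1"
    using has_correlation_ge[OF pm(1) pm(2) a'b'] .
  show "F \<theta> \<le> 2 - cos (\<theta> $ 1) - cos (\<theta> $ 2) - cos (\<theta> $ 3)"
    using bell_inequality[OF pm(1) pm(1) pm(2) pm(2) ab a'b ab' a'b'] by simp
  show "F \<theta> = - cos (\<theta> $ 3)" if "\<theta> $ 1 = \<theta> $ 2"
  proof -
    have "?a' = ?a" using that by (simp add: outcome_seq_def q_def)
    then show ?thesis using has_correlation_unique[OF a'b'] ab' by simp
  qed
  show "F \<theta> = - cos (\<theta> $ 2)" if "\<theta> $ 1 = \<theta> $ 3"
  proof -
    have "?b' = ?b" using that by (simp add: outcome_seq_def q_def)
    then show ?thesis using has_correlation_unique[OF a'b'] a'b by simp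
  qed
qed

lemma convex_Q_plus: "convex Q_plus"
proof (rule convexI)
  fix x y :: "real ^ 3" and u v :: real
  assume *: "x \<in> Q_plus" "y \<in> Q_plus" "0 \<le> u" "0 \<le> v" "u + v = 1"
  have "(u *\<^sub>R x + v *\<^sub>R y) $ i \<in> {0..pi}" for i
  proof -
    have "u *\<^sub>R (x $ i) + v *\<^sub>R (y $ i) \<in> {0..pi}"
      using * by (intro convexD[OF convex_real_interval(5)]) (auto simp: Q_plus_def)
    then show ?thesis by simp
  qed
  then show "u *\<^sub>R x + v *\<^sub>R y \<in> Q_plus" by (simp add: Q_plus_def)
qed

theorem theorem2:
  fixes A B :: "'obs \<Rightarrow> outcome_fun"
    and obs0 :: 'obs
    and tA tB :: "'obs \<Rightarrow> nat \<Rightarrow> real"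
    and F4 :: "real ^ 3 \<Rightarrow> real"
  assumes "CMR A B"
    and "QM (A obs0) (B obs0)"
    and "observers_of_both_kinds tA tB"
    and "REACP tA tB A B"
    and "is_F4 (A obs0) (B obs0) F4"
    and "twice_differentiable_at_within F4 0 Q_plus"
  shows "(3::real) = 1"
proof -
  let ?v = "\<lambda>i j k. vector [i, j, k] :: real ^ 3"
  note F4 = F4_ge[OF assms(1-5)] F4_le[OF assms(1-5)] F4_eq_12[OF assms(1-5)]
    F4_eq_13[OF assms(1-5)]
  have Q: "?v i j k \<in> Q_plus \<longleftrightarrow> {i, j, k} \<subseteq> {0..pi}" for i j k
    by (auto simp: Q_plus_def forall_3)
  have add: "?v i j k + ?v i' j' k' = ?v (i + i') (j + j') (k + k')" for i j k i' j' k'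
    by (simp add: vec_eq_iff forall_3)
  have scale: "t *\<^sub>R ?v i j k = ?v (t * i) (t * j) (t * k)" for t i j k
    by (simp add: vec_eq_iff forall_3)
  have zero: "0 = ?v 0 0 0"
    by (simp add: vec_eq_iff forall_3)
  have "1 \<le> pi" using pi_ge_two by simp
  define R where "R t = F4 (?v t t t) - F4 (?v t t 0) - F4 (?v t 0 t) - F4 (?v 0 t t)
            + F4 (?v t 0 0) + F4 (?v 0 t 0) + F4 (?v 0 0 t) - F4 (?v 0 0 0)" for t
  have "((\<lambda>t. (F4 (t *\<^sub>R (?v 1 0 0 + ?v 0 1 0 + ?v 0 0 1)) - F4 (t *\<^sub>R (?v 1 0 0 + ?v 0 1 0))
      - F4 (t *\<^sub>R (?v 1 0 0 + ?v 0 0 1)) - F4 (t *\<^sub>R (?v 0 1 0 + ?v 0 0 1))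
      + F4 (t *\<^sub>R ?v 1 0 0) + F4 (t *\<^sub>R ?v 0 1 0) + F4 (t *\<^sub>R ?v 0 0 1) - F4 0) / t\<^sup>2) \<longlongrightarrow> 0)
      (at_right 0)"
    using \<open>1 \<le> pi\<close>
    by (intro third_mixed_difference_tendsto_0[OF assms(6) convex_Q_plus])
      (simp_all only: zero add Q, simp_all)
  then have "((\<lambda>t. R t / t\<^sup>2) \<longlongrightarrow> 0) (at_right 0)"
    by (simp only: add scale zero R_def) simp
  moreover have "((\<lambda>t. (1 - cos t) / t\<^sup>2) \<longlongrightarrow> (1 / 2 :: real)) (at_right 0)"
    by real_asymp
  moreover have "\<forall>\<^sub>F t in at_right 0. (1 - cos t) / t\<^sup>2 \<le> R t / t\<^sup>2"
  proof -
    have "(1 - cos t) / t\<^sup>2 \<le> R t / t\<^sup>2" if "0 < t" "t < 1" for t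
    proof -
      have t: "0 \<le> t" "t \<le> pi" using that \<open>1 \<le> pi\<close> by auto
      \<comment> \<open>Six vertices lie on one of the planes
        \<open>\<theta> $ 1 = \<theta> $ 2\<close> and \<open>\<theta> $ 1 = \<theta> $ 3\<close>,
        where \<open>F4\<close> is known exactly. The other two are only bounded, each in the
        direction that its sign in \<open>R\<close> requires.\<close>
      have "F4 (?v t t t) = - cos t" "F4 (?v t t 0) = -1" "F4 (?v t 0 t) = -1"
        "F4 (?v 0 t 0) = - cos t" "F4 (?v 0 0 t) = - cos t" "F4 (?v 0 0 0) = -1"
        using F4(3)[of "?v t t t"] F4(3)[of "?v t t 0"] F4(4)[of "?v t 0 t"]
          F4(4)[of "?v 0 t 0"] F4(3)[of "?v 0 0 t"] F4(3)[of "?v 0 0 0"] t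
        by (simp_all add: Q)
      moreover have "F4 (?v t 0 0) \<ge> -1" "F4 (?v 0 t t) \<le> 1 - 2 * cos t"
        using F4(1)[of "?v t 0 0"] F4(2)[of "?v 0 t t"] t by (simp_all add: Q)
      \<comment> \<open>The exact values contribute \<open>3 - 3 * cos t\<close>, the two bounds at
        least \<open>-1 - (1 - 2 * cos t)\<close>.\<close>
      ultimately have "1 - cos t \<le> R t" unfolding R_def by linarith
      then show ?thesis by (simp add: divide_right_mono)
    qed
    then show ?thesis unfolding eventually_at_right_field by (intro exI[of _ 1]) auto
  qed
  ultimately have "(1 / 2 :: real) \<le> 0"
    by (intro tendsto_le[of "at_right 0"]) auto
  then show ?thesis by simp
qed

end
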